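(* For all $u,v,x\in\mathbb{R}$ with $u,v\ne0$ and $u\ne v$, there exists a probability distribution $\mu$ on $\mathbb{R}$ (with compact support) whose free $R$-transform is \[ R_\mu(w)=\frac{(u-x)^3}{u^2(u-v)}\cdot\frac{uw}{1-uw}+\frac{(v-x)^3}{v^2(v-u)}\cdot\frac{vw}{1-vw}. \]
   Context: For a compactly supported probability distribution $\mu$ on $\mathbb{R}$ let $M_\mu(z)=\int_{\mathbb{R}}\frac{\mu(dx)}{1-xz}$ for $z$ near $0$. The free $R$-transform $R_\mu$ is the analytic function near $0$ determined by $1+R_\mu(zM_\mu(z))=M_\mu(z)$ for $z$ near $0$. *)

theory Defs
  imports "HOL-Probability.Probability" "HOL-Complex_Analysis.Complex_Analysis"
begin

definition compactly_supported :: "real measure \<Rightarrow> bool" where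
  "compactly_supported \<mu> \<longleftrightarrow> (\<exists>K. compact K \<and> (AE x in \<mu>. x \<in> K))"

definition moment_gf :: "real measure \<Rightarrow> complex \<Rightarrow> complex" where
  "moment_gf \<mu> z = (LINT x|\<mu>. 1 / (1 - complex_of_real x * z))"

(* The R-transform is only a germ at 0, so it is rendered as a predicate on its representatives.
   For compactly supported \<mu>, z * moment_gf \<mu> z is analytic at 0 with derivative 1 there, so the
   functional equation determines R near 0. *)
definition has_free_R_transform :: "real measure \<Rightarrow> (complex \<Rightarrow> complex) \<Rightarrow> bool" where
  "has_free_R_transform \<mu> R \<longleftrightarrow>
     R analytic_on {0} \<and>
     (\<forall>\<^sub>F z in nhds 0. 1 + R (z * moment_gf \<mu> z) = moment_gf \<mu> z)"

end

(* Write y for the germ w * moment_gf mu w. The prescribed R-transform amounts to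
   1/w = (1 - x y)^3 / (y (1 - u y) (1 - v y)) + x^3/(u v), because the weights are the residues of the
   cubic expression. With t = y / (1 - x y) and c = x^3/(u v) this becomes
   t (1 - (u-x) t) (1 - (v-x) t) = w / (1 - c w), a cubic with real roots. Its inverse branch through 0
   extends to a holomorphic self-map of the upper half-plane: on the right component of the preimage of
   the half-plane, the divided difference of the cubic does not vanish (injectivity), and the image is
   open and closed in the half-plane (surjectivity). Real Moebius maps with a fixed point at 0 preserve
   this, so y is the germ at 0 of a Nevanlinna function. Such a germ with y'(0) = 1 comes from a
   compactly supported probability measure: take Im y slightly off the real axis as a density in 1/w,
   extract a weak limit, and move the contour to a circle to evaluate it by Cauchy's formula. *)
theory Submission imports Defs
begin

subsection \<open>Inverting a cubic with real roots on the half-plane\<close>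

definition real_rooted_cubic :: "real \<Rightarrow> real \<Rightarrow> complex \<Rightarrow> complex" where
  "real_rooted_cubic a b t = t * (1 - of_real a * t) * (1 - of_real b * t)"

lemma holomorphic_real_rooted_cubic: "real_rooted_cubic a b holomorphic_on S"
  unfolding real_rooted_cubic_def by (intro holomorphic_intros)

lemma continuous_on_real_rooted_cubic [continuous_intros]:
  "continuous_on S f \<Longrightarrow> continuous_on S (\<lambda>x. real_rooted_cubic a b (f x))"
  unfolding real_rooted_cubic_def by (intro continuous_intros)

text \<open>Real coefficients let \<open>Im t\<close> split off; for \<open>t\<close> in the upper
  half-plane the sign of the other factor decides on which side of the real axis the value
  lies.\<close>

lemma im_real_rooted_cubic:
  fixes a b :: real and t :: complex
  shows "Im (real_rooted_cubic a b t) =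
    Im t * (1 - 2 * (a + b) * Re t + a * b * (3 * (Re t)\<^sup>2 - (Im t)\<^sup>2))"
  by (simp add: real_rooted_cubic_def power2_eq_square algebra_simps)

text \<open>The difference of the two values factors into \<open>t1 - t2\<close> and this symmetric
  quadratic, so injectivity reduces to the quadratic not vanishing.\<close>

lemma real_rooted_cubic_divided_difference:
  fixes a b :: real and t1 t2 :: complex
  assumes "real_rooted_cubic a b t1 =
           real_rooted_cubic a b t2" and "t1 \<noteq> t2"
  shows "1 - of_real (a + b) * (t1 + t2) + of_real (a * b) * (t1\<^sup>2 + t1 * t2 + t2\<^sup>2) = 0"
proof -
  have "(t1 - t2) * (1 - of_real (a + b) * (t1 + t2) + of_real (a * b) * (t1\<^sup>2 + t1 * t2 + t2\<^sup>2)) = 0"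
    using assms(1) by (simp add: real_rooted_cubic_def power2_eq_square algebra_simps)
  then show ?thesis using assms(2) by simp
qed

text \<open>The preimage of the upper half-plane under the cubic can have two components in the upper
  half-plane, but only when \<open>a b > 0\<close>; they are then separated by the vertical line through the
  centroid \<open>(a + b) / (3 a b)\<close> of the roots \<open>0, 1/a, 1/b\<close>. The last condition selects the side
  that contains \<open>0\<close>.\<close>

definition cubic_sheet :: "real \<Rightarrow> real \<Rightarrow> complex set" where
  "cubic_sheet a b = {t. Im t > 0 \<and> Im (real_rooted_cubic a b t) > 0 \<and>
     (a * b > 0 \<longrightarrow> (a + b) * (a + b - 3 * (a * b) * Re t) > 0)}"

text \<open>Two points with the same value annul the divided difference. For
  \<open>a * b > 0\<close> the sheet condition gives its imaginary part a strict sign; for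
  \<open>a * b = 0\<close> that part is a nonzero multiple of \<open>y1 + y2\<close>; for
  \<open>a * b < 0\<close> its real part is positive.\<close>

lemma cubic_sheet_inj:
  assumes "a \<noteq> b"
  shows "inj_on (real_rooted_cubic a b) (cubic_sheet a b)"
proof (rule inj_onI, rule ccontr)
  fix t1 t2 :: complex
  assume t1: "t1 \<in> cubic_sheet a b" and t2: "t2 \<in> cubic_sheet a b"
    and eq: "real_rooted_cubic a b t1 =
             real_rooted_cubic a b t2" and ne: "t1 \<noteq> t2"
  obtain x1 y1 x2 y2 where t: "t1 = Complex x1 y1" "t2 = Complex x2 y2"
    by (metis complex.exhaust)
  define s p where "s = a + b" and "p = a * b"
  have y: "y1 > 0" "y2 > 0"
    using t1 t2 by (auto simp: cubic_sheet_def t)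
  have h: "1 - 2 * s * x1 + p * (3 * x1\<^sup>2 - y1\<^sup>2) > 0" "1 - 2 * s * x2 + p * (3 * x2\<^sup>2 - y2\<^sup>2) > 0"
    using t1 t2 y unfolding cubic_sheet_def mem_Collect_eq im_real_rooted_cubic
    by (auto simp: t s_def p_def zero_less_mult_iff)
  have dd: "1 - of_real s * (t1 + t2) + of_real p * (t1\<^sup>2 + t1 * t2 + t2\<^sup>2) = 0"
    using real_rooted_cubic_divided_difference[OF eq ne] by (simp add: s_def p_def)
  have re: "1 - s * (x1 + x2) + p * (x1\<^sup>2 + x1 * x2 + x2\<^sup>2 - y1\<^sup>2 - y2\<^sup>2 - y1 * y2) = 0"
    using arg_cong[OF dd, of Re] by (simp add: t power2_eq_square algebra_simps)
  have im: "y1 * (p * (2 * x1 + x2) - s) + y2 * (p * (2 * x2 + x1) - s) = 0"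
    using arg_cong[OF dd, of Im] by (simp add: t power2_eq_square algebra_simps)
  consider "p > 0" | "p = 0" | "p < 0" by linarith
  then show False
  proof cases
    case 1
    have k: "s * (s - 3 * p * x1) > 0" "s * (s - 3 * p * x2) > 0"
      using t1 t2 1 by (auto simp: cubic_sheet_def t s_def p_def)
    \<comment> \<open>These are weighted means of the facts \<open>k\<close>, with weights 2/3 and
      1/3.\<close>
    have "s * (s - p * (2 * x1 + x2)) > 0" "s * (s - p * (2 * x2 + x1)) > 0"
      using k by (auto simp: algebra_simps)
    then have "y1 * (s * (s - p * (2 * x1 + x2))) + y2 * (s * (s - p * (2 * x2 + x1))) > 0"
      using y by (simp add: add_pos_pos)
    moreover have "y1 * (s * (s - p * (2 * x1 + x2))) + y2 * (s * (s - p * (2 * x2 + x1))) =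
      - s * (y1 * (p * (2 * x1 + x2) - s) + y2 * (p * (2 * x2 + x1) - s))"
      by (simp add: algebra_simps)
    ultimately show False unfolding im by simp
  next
    case 2
    have "s \<noteq> 0" using 2 assms unfolding s_def p_def by auto
    moreover have "s * (y1 + y2) = 0" using im 2 by (simp add: algebra_simps)
    ultimately show False using y by simp
  next
    case 3
    \<comment> \<open>The real part is the mean of the two positive quantities in \<open>h\<close>
      plus a sum of squares with coefficient \<open>- p / 2\<close>.\<close>
    have "0 = ((1 - 2 * s * x1 + p * (3 * x1\<^sup>2 - y1\<^sup>2)) + (1 - 2 * s * x2 + p * (3 * x2\<^sup>2 - y2\<^sup>2))) / 2
      + (- p) * (((x1 - x2)\<^sup>2 + (y1 + y2)\<^sup>2) / 2)"
      by (subst re[symmetric]) (simp add: power2_eq_square field_simps)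
    moreover have "(- p) * (((x1 - x2)\<^sup>2 + (y1 + y2)\<^sup>2) / 2) \<ge> 0"
      using 3 by (intro mult_nonneg_nonneg) auto
    ultimately show False using add_pos_pos[OF h] by argo
  qed
qed

section \<open>Surjectivity of the cubic from the sheet onto the half-plane\<close>

lemma open_cubic_sheet: "open (cubic_sheet a b)"
proof -
  have "open {t::complex. Im t > 0 \<and> Im (real_rooted_cubic a b t) > 0}"
    by (intro open_Collect_conj open_Collect_less continuous_intros)
  moreover have "open {t::complex. (a + b) * (a + b - 3 * (a * b) * Re t) > 0}"
    by (intro open_Collect_less continuous_intros)
  ultimately show ?thesis
    by (cases "a * b > 0") (simp_all add: cubic_sheet_def Collect_conj_eq open_Int flip: Int_assoc)
qed

text \<open>Properness: far from 0 both linear factors have modulus at least 1. Hence preimages of a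
  bounded sequence are bounded.\<close>

lemma norm_le_real_rooted_cubic:
  fixes a b :: real
  shows "\<exists>K. \<forall>t. K \<le> norm t \<longrightarrow> norm t \<le> norm (real_rooted_cubic a b t)"
proof (intro exI allI impI)
  \<comment> \<open>For \<open>c = 0\<close> the threshold \<open>2 / \<bar>c\<bar>\<close> is 0 by
    convention, and the factor is constantly 1.\<close>
  have lin: "1 \<le> norm (1 - of_real c * t)" if "2 / \<bar>c\<bar> \<le> norm t" for c :: real and t :: complex
  proof (cases "c = 0")
    case False
    have "2 \<le> norm (of_real c * t)"
      using that False by (simp add: norm_mult field_simps)
    then show ?thesis
      using norm_triangle_ineq2[of "of_real c * t" 1] by (simp add: norm_minus_commute)
  qed auto
  fix t :: complex
  assume "max (2 / \<bar>a\<bar>) (2 / \<bar>b\<bar>) \<le> norm t"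
  then have "1 \<le> norm (1 - of_real a * t)" "1 \<le> norm (1 - of_real b * t)"
    using lin by auto
  then have "1 * 1 \<le> norm (1 - of_real a * t) * norm (1 - of_real b * t)"
    by (intro mult_mono) auto
  then have "norm t * 1 \<le> norm t * (norm (1 - of_real a * t) * norm (1 - of_real b * t))"
    by (intro mult_left_mono) auto
  then show "norm t \<le> norm (real_rooted_cubic a b t)"
    by (simp add: real_rooted_cubic_def norm_mult mult.assoc)
qed

text \<open>The strict inequalities could only degenerate on the real axis, where the cubic is real,
  or on the separating line through the centroid, where it maps the upper half-plane into the lower
  one.\<close>

lemma cubic_sheet_limit:
  assumes "a \<noteq> b" and lim: "f \<longlonglongrightarrow> t" and f: "\<And>n::nat. f n \<in> cubic_sheet a b"
    and pos: "Im (real_rooted_cubic a b t) > 0"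
  shows "t \<in> cubic_sheet a b"
proof -
  have "Im t \<ge> 0"
    by (rule tendsto_lowerbound[OF tendsto_Im[OF lim]])
       (use f in \<open>auto simp: cubic_sheet_def intro!: always_eventually less_imp_le\<close>)
  moreover have "Im t \<noteq> 0"
    using pos unfolding im_real_rooted_cubic by auto
  ultimately have y: "Im t > 0" by simp
  have h: "1 - 2 * (a + b) * Re t + a * b * (3 * (Re t)\<^sup>2 - (Im t)\<^sup>2) > 0"
    using pos y unfolding im_real_rooted_cubic by (simp add: zero_less_mult_iff)
  have "(a + b) * (a + b - 3 * (a * b) * Re t) > 0" if p: "a * b > 0"
  proof -
    have "(\<lambda>n. (a + b) * (a + b - 3 * (a * b) * Re (f n))) \<longlonglongrightarrow> (a + b) * (a + b - 3 * (a * b) * Re t)"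
      by (intro tendsto_intros lim)
    then have "(a + b) * (a + b - 3 * (a * b) * Re t) \<ge> 0"
      by (rule tendsto_lowerbound)
         (use f p in \<open>auto simp: cubic_sheet_def intro!: always_eventually less_imp_le\<close>)
    moreover have "(a + b) * (a + b - 3 * (a * b) * Re t) \<noteq> 0"
    proof
      assume "(a + b) * (a + b - 3 * (a * b) * Re t) = 0"
      moreover have "a + b \<noteq> 0" using p by (auto simp: zero_less_mult_iff)
      ultimately have s: "a + b = 3 * (a * b) * Re t" by simp
      \<comment> \<open>On the separating line this quantity is negative, because
        \<open>(a + b)\<^sup>2 > 3 * (a * b)\<close>.\<close>
      have "0 < a * b * (1 - 2 * (a + b) * Re t + a * b * (3 * (Re t)\<^sup>2 - (Im t)\<^sup>2))"
        using h p by simp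
      also have "a * b * (1 - 2 * (a + b) * Re t + a * b * (3 * (Re t)\<^sup>2 - (Im t)\<^sup>2)) =
         a * b - (a + b)\<^sup>2 / 3 - (a * b * Im t)\<^sup>2"
        unfolding s by (simp add: power2_eq_square field_simps)
      also have "\<dots> < 0"
      proof -
        have "(a + b)\<^sup>2 - 3 * (a * b) = (a - b / 2)\<^sup>2 + 3 / 4 * b\<^sup>2"
          by (simp add: power2_eq_square field_simps)
        moreover have "b\<^sup>2 > 0" using p by auto
        ultimately show ?thesis
          using zero_le_power2[of "a - b / 2"] zero_le_power2[of "a * b * Im t"] by argo
      qed
      finally show False by (rule less_irrefl[THEN notE, rotated])
    qed
    ultimately show ?thesis by (metis order_le_less)
  qed
  then show ?thesis using y pos by (auto simp: cubic_sheet_def)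
qed

text \<open>At 0 the sign factor is 1 and the side condition is strict. The first disjunct yields a
  point of the sheet; the second places values of a local inverse in it.\<close>

lemma cubic_sheet_near_0:
  "\<exists>r>0. \<forall>t. norm t < r \<longrightarrow> Im t > 0 \<or> Im (real_rooted_cubic a b t) > 0 \<longrightarrow> t \<in> cubic_sheet a b"
proof -
  define k where "k t = 1 - 2 * (a + b) * Re t + a * b * (3 * (Re t)\<^sup>2 - (Im t)\<^sup>2)" for t
  \<comment> \<open>The value 1 stands for the side condition being vacuous.\<close>
  define l where "l t = (if a * b > 0 then (a + b) * (a + b - 3 * (a * b) * Re t) else 1)" for t
  have "a * b > 0 \<Longrightarrow> 0 < (a + b) * (a + b)"
    by (auto simp: zero_less_mult_iff)
  then have l0: "l 0 > 0" by (auto simp: l_def)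
  have "((\<lambda>t. k t) \<longlongrightarrow> k 0) (nhds 0)"
    unfolding k_def by (intro tendsto_intros filterlim_ident)
  then have 1: "\<forall>\<^sub>F t in nhds 0. k t > 0"
    by (rule order_tendstoD) (simp add: k_def)
  have "((\<lambda>t. l t) \<longlongrightarrow> l 0) (nhds 0)"
    unfolding l_def by (cases "a * b > 0") (simp_all only: if_True if_False, (intro tendsto_intros filterlim_ident)+)
  then have 2: "\<forall>\<^sub>F t in nhds 0. l t > 0"
    by (rule order_tendstoD) (rule l0)
  obtain r where r: "r > 0" "\<And>t. norm t < r \<Longrightarrow> k t > 0 \<and> l t > 0"
    using eventually_conj[OF 1 2] unfolding eventually_nhds_metric by (auto simp: dist_norm)
  show ?thesis
  proof (intro exI[of _ r] conjI r(1) allI impI)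
    fix t :: complex
    assume t: "norm t < r" and im: "Im t > 0 \<or> Im (real_rooted_cubic a b t) > 0"
    have l: "a * b > 0 \<longrightarrow> (a + b) * (a + b - 3 * (a * b) * Re t) > 0"
      using r(2)[OF t] by (auto simp: l_def)
    have k: "Im (real_rooted_cubic a b t) = Im t * k t"
      unfolding im_real_rooted_cubic k_def ..
    show "t \<in> cubic_sheet a b"
      using im l r(2)[OF t] unfolding cubic_sheet_def mem_Collect_eq k by (auto simp: zero_less_mult_iff)
  qed
qed

text \<open>Injectivity and the open mapping theorem make the image open; properness and
  \<open>cubic_sheet_limit\<close> make it relatively closed.\<close>

lemma cubic_sheet_image:
  assumes "a \<noteq> b"
  shows "(real_rooted_cubic a b) ` cubic_sheet a b = {w. Im w > 0}"
    (is "?q ` _ = ?H")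
proof -
  have sub: "?q ` cubic_sheet a b \<subseteq> ?H" by (auto simp: cubic_sheet_def)
  have conn: "connected ?H"
    by (intro convex_connected convex_halfspace_Im_gt)
  have op: "open (?q ` cubic_sheet a b)"
    by (rule open_mapping_thm3[OF holomorphic_real_rooted_cubic open_cubic_sheet cubic_sheet_inj[OF assms]])
  \<comment> \<open>Preimages of a convergent sequence stay bounded, so a subsequence converges, and
    its limit is a preimage in the sheet.\<close>
  have cl: "\<exists>t\<in>cubic_sheet a b. w = ?q t" if w: "Im w > 0" and lim: "g \<longlonglongrightarrow> w" and
    g: "\<And>n::nat. g n \<in> ?q ` cubic_sheet a b" for w g
  proof -
    have "\<forall>n. \<exists>t. t \<in> cubic_sheet a b \<and> g n = ?q t" using g by blast
    then obtain f where f: "\<And>n. f n \<in> cubic_sheet a b" "\<And>n. g n = ?q (f n)"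
      unfolding choice_iff by blast
    have "Bseq g" using lim by (intro convergent_imp_Bseq convergentI)
    then obtain B where B: "\<And>n. norm (g n) \<le> B" unfolding Bseq_def by metis
    obtain K where K: "\<forall>t. K \<le> norm t \<longrightarrow> norm t \<le> norm (?q t)"
      using norm_le_real_rooted_cubic ..
    have "norm (f n) \<le> max K B" for n
      using K[rule_format, of "f n"] B[of n] f(2)[of n] by (cases "K \<le> norm (f n)") auto
    then have "bounded (range f)" by (auto simp: bounded_iff)
    from bounded_imp_convergent_subsequence[OF this]
    obtain t r where r: "strict_mono (r :: nat \<Rightarrow> nat)" "(f \<circ> r) \<longlonglongrightarrow> t"
      by metis
    have "(\<lambda>n. ?q ((f \<circ> r) n)) \<longlonglongrightarrow> ?q t"
      unfolding real_rooted_cubic_def by (intro tendsto_intros r(2))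
    moreover have "(\<lambda>n. ?q ((f \<circ> r) n)) = g \<circ> r"
      using f(2) by auto
    ultimately have "(g \<circ> r) \<longlonglongrightarrow> ?q t" by simp
    then have eq: "?q t = w"
      by (rule LIMSEQ_unique) (rule LIMSEQ_subseq_LIMSEQ[OF lim r(1)])
    have "t \<in> cubic_sheet a b"
      by (rule cubic_sheet_limit[OF assms r(2)]) (use f(1) w eq in auto)
    with eq show ?thesis by auto
  qed
  have ope: "openin (top_of_set ?H) (?q ` cubic_sheet a b)"
    by (rule open_subset[OF sub op])
  have clo: "closedin (top_of_set ?H) (?q ` cubic_sheet a b)"
    unfolding closedin_limpt
  proof (intro conjI sub allI impI)
    fix w assume w: "w islimpt ?q ` cubic_sheet a b \<and> w \<in> ?H"
    then have "\<exists>g. (\<forall>n::nat. g n \<in> ?q ` cubic_sheet a b - {w}) \<and> g \<longlonglongrightarrow> w"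
      by (simp only: islimpt_sequential)
    then obtain g where g: "(\<forall>n::nat. g n \<in> ?q ` cubic_sheet a b - {w}) \<and> g \<longlonglongrightarrow> w" ..
    have "\<exists>t\<in>cubic_sheet a b. w = ?q t"
      by (rule cl[of w g]) (use w g in auto)
    then show "w \<in> ?q ` cubic_sheet a b" by (simp only: image_iff)
  qed
  have ne: "?q ` cubic_sheet a b \<noteq> {}"
  proof -
    obtain r where "r > 0" "\<forall>t. norm t < r \<longrightarrow> Im t > 0 \<or> Im (?q t) > 0 \<longrightarrow> t \<in> cubic_sheet a b"
      using cubic_sheet_near_0[of a b] by (elim exE conjE)
    then have "\<i> * of_real (r / 2) \<in> cubic_sheet a b" by (auto simp: norm_mult)
    then show ?thesis by blast
  qed
  show ?thesis
    using conn[unfolded connected_clopen, rule_format, OF conjI[OF ope clo]] ne by simp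
qed

section \<open>The inverse branch, on the half-plane and near 0\<close>

lemma holomorphic_left_inverse:
  assumes "f holomorphic_on S" "open S" "inj_on f S"
  shows "\<exists>g. g holomorphic_on f ` S \<and> (\<forall>z\<in>S. g (f z) = z)"
  using holomorphic_has_inverse[OF assms] by metis

text \<open>\<open>\<tau>\<close> inverts the cubic on the sheet and carries positivity;
  \<open>g\<close> inverts it near 0, where its derivative is 1. They agree because both take values
  in the sheet, where the cubic is injective.\<close>

proposition cubic_inverse_branch:
  fixes a b :: real
  assumes "a \<noteq> b"
  obtains \<tau> g \<delta> where
    "\<tau> holomorphic_on {w. Im w > 0}"
    "\<And>w. Im w > 0 \<Longrightarrow> Im (\<tau> w) > 0"
    "\<delta> > 0" "g holomorphic_on ball 0 \<delta>" "g 0 = 0"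
    "\<And>w. norm w < \<delta> \<Longrightarrow> real_rooted_cubic a b (g w) = w"
    "\<And>w. norm w < \<delta> \<Longrightarrow> g (cnj w) = cnj (g w)"
    "\<And>w. norm w < \<delta> \<Longrightarrow> Im w > 0 \<Longrightarrow> g w = \<tau> w"
proof -
  let ?q = "real_rooted_cubic a b"
  have hol: "?q holomorphic_on S" for S by (rule holomorphic_real_rooted_cubic)
  have "\<exists>\<tau>. \<tau> holomorphic_on ?q ` cubic_sheet a b \<and> (\<forall>t\<in>cubic_sheet a b. \<tau> (?q t) = t)"
    by (rule holomorphic_left_inverse[OF hol open_cubic_sheet cubic_sheet_inj[OF assms]])
  then obtain \<tau> where \<tau>: "\<tau> holomorphic_on ?q ` cubic_sheet a b \<and> (\<forall>t\<in>cubic_sheet a b. \<tau> (?q t) = t)" ..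
  have \<tau>q: "\<tau> w \<in> cubic_sheet a b" "?q (\<tau> w) = w" if "Im w > 0" for w
  proof -
    have "w \<in> ?q ` cubic_sheet a b" unfolding cubic_sheet_image[OF assms] using that by simp
    then obtain t where "w = ?q t" "t \<in> cubic_sheet a b" by (rule imageE)
    then show "\<tau> w \<in> cubic_sheet a b" "?q (\<tau> w) = w" using \<tau> by auto
  qed
  have "(?q has_field_derivative 1) (at 0)"
    unfolding real_rooted_cubic_def[abs_def] by (auto intro!: derivative_eq_intros)
  then have dq: "deriv ?q 0 \<noteq> 0" by (simp add: DERIV_imp_deriv)
  obtain r1 where r1: "r1 > 0" "ball 0 r1 \<subseteq> (UNIV :: complex set)" "inj_on ?q (ball 0 r1)"
    by (rule has_complex_derivative_locally_injective[OF hol UNIV_I open_UNIV dq])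
  obtain r2 where r2: "r2 > 0" "\<forall>t. norm t < r2 \<longrightarrow> Im t > 0 \<or> Im (?q t) > 0 \<longrightarrow> t \<in> cubic_sheet a b"
    using cubic_sheet_near_0[of a b] by (elim exE conjE)
  \<comment> \<open>On this disc the cubic is injective and every point with value in the upper
    half-plane belongs to the sheet.\<close>
  define r where "r = min r1 r2"
  have r: "r > 0" "inj_on ?q (ball 0 r)"
    using r1 r2 by (auto simp: r_def intro: inj_on_subset)
  have "\<exists>g. g holomorphic_on ?q ` ball 0 r \<and> (\<forall>t\<in>ball 0 r. g (?q t) = t)"
    by (rule holomorphic_left_inverse[OF hol open_ball r(2)])
  then obtain g where g: "g holomorphic_on ?q ` ball 0 r \<and> (\<forall>t\<in>ball 0 r. g (?q t) = t)" ..
  have "open (?q ` ball 0 r)"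
    by (rule open_mapping_thm3[OF hol open_ball r(2)])
  moreover have "0 \<in> ?q ` ball 0 r" using r(1) by (auto simp: real_rooted_cubic_def intro!: image_eqI[of _ _ 0])
  ultimately obtain \<delta> where \<delta>: "\<delta> > 0" "ball 0 \<delta> \<subseteq> ?q ` ball 0 r"
    by (rule openE)
  have gq: "norm (g w) < r" "?q (g w) = w" if "norm w < \<delta>" for w
  proof -
    have "w \<in> ?q ` ball 0 r" by (rule subsetD[OF \<delta>(2)]) (use that in simp)
    then obtain t where t: "w = ?q t" "t \<in> ball 0 r" by (rule imageE)
    then show "norm (g w) < r" "?q (g w) = w" using g by auto
  qed
  show ?thesis
  proof (rule that[of \<tau> \<delta> g])
    show "\<tau> holomorphic_on {w. Im w > 0}" using \<tau> cubic_sheet_image[OF assms] by simp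
    show "Im (\<tau> w) > 0" if "Im w > 0" for w
      using \<tau>q(1)[OF that] by (simp add: cubic_sheet_def)
    show "g holomorphic_on ball 0 \<delta>" using holomorphic_on_subset[OF conjunct1[OF g] \<delta>(2)] .
    show "g 0 = 0" using g r(1) by (auto simp: real_rooted_cubic_def dest: bspec[of _ _ 0])
    \<comment> \<open>Both sides lie in the conjugation-invariant disc of injectivity and have the
      same value, the cubic having real coefficients.\<close>
    show "g (cnj w) = cnj (g w)" if w: "norm w < \<delta>" for w
    proof -
      have "?q (cnj (g w)) = cnj (?q (g w))" by (simp add: real_rooted_cubic_def)
      then have "?q (g (cnj w)) = ?q (cnj (g w))"
        using gq(2)[OF w] gq(2)[of "cnj w"] w by simp
      then show ?thesis
        by (rule inj_onD[OF r(2)]) (use gq(1)[of w] gq(1)[of "cnj w"] w in auto)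
    qed
    show "g w = \<tau> w" if "norm w < \<delta>" "Im w > 0" for w
    proof (rule inj_onD[OF cubic_sheet_inj[OF assms]])
      show "?q (g w) = ?q (\<tau> w)" using gq(2)[OF that(1)] \<tau>q(2)[OF that(2)] by simp
      show "g w \<in> cubic_sheet a b"
        by (rule r2(2)[rule_format]) (use gq[OF that(1)] that in \<open>auto simp: r_def\<close>)
    qed (rule \<tau>q(1)[OF that(2)])
  qed (use \<delta> gq in auto)
qed

subsection \<open>Weak limits of densities\<close>

text \<open>Normalised to mass 1, the densities are carried by one compact interval, hence tight,
  and have a weakly convergent subsequence. The normalising constants tend to 1 and drop out of the
  limit.\<close>

lemma densities_on_Icc_convergent_subsequence:
  fixes \<rho> :: "nat \<Rightarrow> real \<Rightarrow> real" and a b :: real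
  assumes "a < b"
    and cont: "\<And>n. continuous_on {a..b} (\<rho> n)"
    and pos: "\<And>n x. x \<in> {a..b} \<Longrightarrow> \<rho> n x > 0"
    and mass: "(\<lambda>n. integral {a..b} (\<rho> n)) \<longlonglongrightarrow> 1"
  obtains r \<mu> where "strict_mono (r :: nat \<Rightarrow> nat)" "real_distribution \<mu>" "AE x in \<mu>. x \<in> {a..b}"
    "\<And>f :: real \<Rightarrow> complex. f \<in> borel_measurable borel \<Longrightarrow> continuous_on {a..b} f \<Longrightarrow>
      (\<lambda>n. integral {a..b} (\<lambda>x. \<rho> (r n) x *\<^sub>R f x)) \<longlonglongrightarrow> (LINT x|\<mu>. f x)"
proof -
  define c where "c n = integral {a..b} (\<rho> n)" for n
  have c: "c n > 0" for n
  proof -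
    have "c n \<ge> 0" unfolding c_def
      by (rule integral_nonneg[OF integrable_continuous_real[OF cont]]) (use pos in \<open>auto intro: less_imp_le\<close>)
    moreover have "c n \<noteq> 0"
    proof
      assume "c n = 0"
      then have "\<forall>x\<in>{a..b}. \<rho> n x = 0" unfolding c_def
        by (subst (asm) integral_eq_0_iff[OF cont \<open>a < b\<close>]) (use pos in \<open>auto intro: less_imp_le\<close>)
      then show False using pos[of a n] \<open>a < b\<close> by auto
    qed
    ultimately show ?thesis by simp
  qed
  define g where "g n x = indicator {a..b} x *\<^sub>R (\<rho> n x / c n)" for n x
  have g_meas [measurable]: "g n \<in> borel_measurable borel" for n
    unfolding g_def
    by (intro borel_measurable_continuous_on_indicator continuous_intros cont) (use c[of n] in auto)
  have g_nonneg: "g n x \<ge> 0" for n x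
    using c[of n] pos[of x n] by (auto simp: g_def indicator_def intro!: divide_nonneg_pos less_imp_le)
  define \<nu> where "\<nu> n = density lborel (\<lambda>x. ennreal (g n x))" for n
  have \<nu>_integral: "(LINT x|\<nu> n. f x) = integral {a..b} (\<lambda>x. \<rho> n x *\<^sub>R f x) /\<^sub>R c n"
    if f: "f \<in> borel_measurable borel" "continuous_on {a..b} f" for f :: "real \<Rightarrow> complex" and n
  proof -
    have "(LINT x|\<nu> n. f x) = (LINT x|lborel. g n x *\<^sub>R f x)"
      unfolding \<nu>_def by (rule integral_density) (use f(1) g_nonneg in auto)
    also have "\<dots> = (LINT x:{a..b}|lborel. (\<rho> n x / c n) *\<^sub>R f x)"
      unfolding set_lebesgue_integral_def g_def by (simp add: mult.assoc)
    also have "\<dots> = integral {a..b} (\<lambda>x. (\<rho> n x / c n) *\<^sub>R f x)"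
      by (intro set_borel_integral_eq_integral borel_integrable_atLeastAtMost' continuous_intros cont f(2))
        (use c[of n] in auto)
    also have "\<dots> = integral {a..b} (\<lambda>x. inverse (c n) *\<^sub>R (\<rho> n x *\<^sub>R f x))"
      by (simp add: divide_inverse mult.commute)
    also have "\<dots> = integral {a..b} (\<lambda>x. \<rho> n x *\<^sub>R f x) /\<^sub>R c n"
      by (rule integral_cmul)
    finally show ?thesis .
  qed
  have g_set: "set_integrable lborel {a..b} (\<lambda>x. \<rho> n x / c n)" for n
    by (intro borel_integrable_atLeastAtMost' continuous_intros cont) (use c[of n] in auto)
  have g_int: "integrable lborel (g n)" for n
    using g_set[of n] unfolding set_integrable_def g_def .
  have "(LINT x|lborel. g n x) = integral {a..b} (\<lambda>x. \<rho> n x / c n)" for n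
    using set_borel_integral_eq_integral(2)[OF g_set[of n]] unfolding set_lebesgue_integral_def g_def .
  then have g_total: "(LINT x|lborel. g n x) = 1" for n
    using c[of n] by (simp add: c_def)
  have "emeasure (\<nu> n) (space (\<nu> n)) = 1" for n
    unfolding \<nu>_def
    by (subst emeasure_density) (use nn_integral_eq_integral[OF g_int, of n] g_nonneg g_total[of n] in auto)
  then have \<nu>_prob: "prob_space (\<nu> n)" for n by (rule prob_spaceI)
  have \<nu>_distr: "real_distribution (\<nu> n)" for n
    using \<nu>_prob by (auto simp: real_distribution_def real_distribution_axioms_def \<nu>_def)
  have \<nu>_supp: "AE x in \<nu> n. x \<in> {a..b}" for n
    unfolding \<nu>_def
    by (subst AE_density, use g_meas in measurable) (auto simp: g_def indicator_def intro!: AE_I2)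
  have "tight \<nu>" unfolding tight_def
  proof (intro conjI allI impI \<nu>_distr)
    fix e :: real assume "e > 0"
    \<comment> \<open>Tightness is stated with intervals open on the left, so the left end is moved
      past \<open>a\<close>.\<close>
    have "measure (\<nu> n) {a - 1<..b} = 1" for n
    proof -
      interpret real_distribution "\<nu> n" by (rule \<nu>_distr)
      have "AE x in \<nu> n. x \<in> {a - 1<..b}"
        using \<nu>_supp[of n] by eventually_elim auto
      then show ?thesis by (subst prob_eq_1) auto
    qed
    then show "\<exists>a b. a < b \<and> (\<forall>n. 1 - e < measure (\<nu> n) {a<..b})"
      using \<open>e > 0\<close> \<open>a < b\<close> by (intro exI[of _ "a - 1"] exI[of _ b]) auto
  qed
  then obtain r \<mu> where r: "strict_mono (r :: nat \<Rightarrow> nat)" and \<mu>: "real_distribution \<mu>"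
    and wc: "weak_conv_m (\<nu> \<circ> id \<circ> r) \<mu>"
    using tight_imp_convergent_subsubsequence[OF _ strict_mono_id] by blast
  interpret \<mu>: real_distribution \<mu> by (rule \<mu>)
  have conv: "(\<lambda>n. LINT x|\<nu> (r n). f x) \<longlonglongrightarrow> (LINT x|\<mu>. f x)"
    if "\<And>x. isCont f x" "\<And>x. norm (f x) \<le> B" for f :: "real \<Rightarrow> 'c :: {banach, second_countable_topology}" and B
    using weak_conv_imp_integral_bdd_continuous_conv[of "\<nu> \<circ> id \<circ> r" \<mu> f B] \<nu>_distr \<mu> wc that by simp
  have \<mu>_supp: "AE x in \<mu>. x \<in> {a..b}"
  proof -
    \<comment> \<open>A bounded continuous nonnegative function vanishing exactly on
      \<open>{a..b}\<close>; its integral stays 0 in the limit.\<close>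
    define h where "h x = min 1 (max (a - x) (max (x - b) 0))" for x :: real
    have hcont: "isCont h x" for x
      unfolding h_def by (intro continuous_intros)
    have hbd: "norm (h x) \<le> 1" for x by (auto simp: h_def)
    have "(LINT x|\<nu> n. h x) = 0" for n
      by (rule integral_eq_zero_AE, rule AE_mp[OF \<nu>_supp[of n]]) (auto simp: h_def intro!: AE_I2)
    then have "(LINT x|\<mu>. h x) = 0"
      using LIMSEQ_unique[OF conv[OF hcont hbd]] by simp
    moreover have "integrable \<mu> h"
      by (rule \<mu>.integrable_const_bound[of _ 1])
        (use hbd hcont in \<open>auto intro!: borel_measurable_continuous_onI continuous_at_imp_continuous_on
          simp: measurable_cong_sets[OF \<mu>.events_eq_borel refl]\<close>)
    ultimately have "AE x in \<mu>. h x = 0"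
      by (subst (asm) integral_nonneg_eq_0_iff_AE) (auto simp: h_def)
    then show ?thesis
      by eventually_elim (auto simp: h_def min_def max_def split: if_splits)
  qed
  show ?thesis
  proof (rule that[OF r \<mu> \<mu>_supp])
    fix f :: "real \<Rightarrow> complex"
    assume f_meas: "f \<in> borel_measurable borel" and f: "continuous_on {a..b} f"
    \<comment> \<open>Clamping the argument extends \<open>f\<close> from \<open>{a..b}\<close> to a
      bounded continuous function on the line, as weak convergence requires.\<close>
    define h where "h x = f (max a (min b x))" for x
    have hf: "h x = f x" if "x \<in> {a..b}" for x
      using that by (auto simp: h_def)
    have hcont: "continuous_on A h" for A
      unfolding h_def
      by (rule continuous_on_compose2[OF f]) (use \<open>a < b\<close> in \<open>auto intro!: continuous_intros\<close>)
    have hmeas: "h \<in> borel_measurable borel"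
      by (rule borel_measurable_continuous_onI[OF hcont])
    obtain B where B: "\<And>x. x \<in> {a..b} \<Longrightarrow> norm (f x) \<le> B"
      using compact_imp_bounded[OF compact_continuous_image[OF f compact_Icc]]
      unfolding bounded_iff by blast
    have hbd: "norm (h x) \<le> B" for x
      unfolding h_def by (rule B) (use \<open>a < b\<close> in auto)
    have "(\<lambda>n. LINT x|\<nu> (r n). h x) \<longlonglongrightarrow> (LINT x|\<mu>. h x)"
      by (rule conv[OF _ hbd]) (use hcont[of UNIV] in \<open>simp add: continuous_on_eq_continuous_at\<close>)
    also have "(\<lambda>n. LINT x|\<nu> (r n). h x) = (\<lambda>n. integral {a..b} (\<lambda>x. \<rho> (r n) x *\<^sub>R f x) /\<^sub>R c (r n))"
      unfolding \<nu>_integral[OF hmeas hcont]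
      by (intro ext arg_cong[where f = "\<lambda>z. z /\<^sub>R _"] integral_cong) (simp add: hf)
    finally have "(\<lambda>n. integral {a..b} (\<lambda>x. \<rho> (r n) x *\<^sub>R f x) /\<^sub>R c (r n)) \<longlonglongrightarrow> (LINT x|\<mu>. h x)" .
    moreover have "(\<lambda>n. c (r n)) \<longlonglongrightarrow> 1"
      using LIMSEQ_subseq_LIMSEQ[OF mass r] by (simp add: c_def o_def)
    ultimately have "(\<lambda>n. c (r n) *\<^sub>R (integral {a..b} (\<lambda>x. \<rho> (r n) x *\<^sub>R f x) /\<^sub>R c (r n)))
        \<longlonglongrightarrow> 1 *\<^sub>R (LINT x|\<mu>. h x)"
      by (intro tendsto_scaleR)
    moreover have "c n \<noteq> 0" for n using c[of n] by simp
    moreover have "(LINT x|\<mu>. h x) = (LINT x|\<mu>. f x)"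
    proof (rule integral_cong_AE)
      show "AE x in \<mu>. h x = f x" using \<mu>_supp by (rule eventually_mono) (rule hf)
    qed (use hmeas f_meas in auto)
    ultimately show "(\<lambda>n. integral {a..b} (\<lambda>x. \<rho> (r n) x *\<^sub>R f x)) \<longlonglongrightarrow> (LINT x|\<mu>. f x)"
      by simp
  qed
qed

subsection \<open>Nevanlinna germs are moment generating functions\<close>

lemma Im_inverse_pos: "Im z < 0 \<Longrightarrow> Im (1 / z) > 0"
  by (simp add: Im_divide divide_neg_pos sum_power2_gt_zero_iff)

text \<open>\<open>P w\<close> has the role of the Cauchy transform at \<open>1 / w\<close>: for a
  measure with moment generating function \<open>M\<close> it would be the integral of
  \<open>1 / (1 / w - x)\<close>, whose imaginary part is positive for \<open>1 / w\<close> in the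
  lower half-plane.\<close>

locale nevanlinna_germ =
  fixes M P :: "complex \<Rightarrow> complex" and \<delta> :: real
  assumes \<delta>_pos: "\<delta> > 0"
    and M_holo: "M holomorphic_on ball 0 \<delta>"
    and M_0: "M 0 = 1"
    and M_cnj: "norm w < \<delta> \<Longrightarrow> M (cnj w) = cnj (M w)"
    and P_holo: "P holomorphic_on {w. Im w > 0}"
    and P_pos: "Im w > 0 \<Longrightarrow> Im (P w) > 0"
    and P_eq: "norm w < \<delta> \<Longrightarrow> Im w > 0 \<Longrightarrow> P w = w * M w"
begin

text \<open>The contour integrals live in the plane of \<open>\<zeta> = 1 / w\<close>: the germ \<open>M (1 / \<zeta>)\<close> is defined
  for \<open>|\<zeta>| > R / 2\<close>, and the measure will be supported in \<open>[-R, R]\<close>. The test function is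
  \<open>1 / (1 - \<zeta> w)\<close>, and on the shifted arc \<open>P\<close> is replaced by the germ, so that
  \<open>\<epsilon> = 0\<close> is allowed there.\<close>

definition R :: real where "R = 2 / \<delta>"

definition segment_integral :: "complex \<Rightarrow> real \<Rightarrow> complex" where
  "segment_integral w \<epsilon> = integral {- R..R}
     (\<lambda>x. 1 / (1 - of_real x * w) * P (1 / (of_real x - \<i> * of_real \<epsilon>)))"

definition arc_integrand :: "complex \<Rightarrow> real \<Rightarrow> real \<Rightarrow> complex" where
  "arc_integrand w \<epsilon> t = (let \<zeta> = of_real R * cis t; v = 1 / (\<zeta> - \<i> * of_real \<epsilon>)
     in 1 / (1 - \<zeta> * w) * (v * M v) * (\<i> * \<zeta>))"

definition arc_integral :: "complex \<Rightarrow> real \<Rightarrow> complex" where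
  "arc_integral w \<epsilon> = integral {pi..2 * pi} (arc_integrand w \<epsilon>)"

section \<open>Moving the contour from the real segment to the lower arc\<close>

lemma R_pos: "R > 0" using \<delta>_pos by (simp add: R_def)

text \<open>Since \<open>\<delta> / 4 = 1 / (2 * R)\<close>, the pole \<open>1 / w\<close> of the
  test function lies outside the disc of radius \<open>2 * R\<close>.\<close>

lemma test_function_nonzero:
  fixes w \<zeta> :: complex
  assumes "norm w < \<delta> / 4" "norm \<zeta> < 2 * R"
  shows "1 - \<zeta> * w \<noteq> 0"
proof -
  have "norm (\<zeta> * w) < (2 * R) * (\<delta> / 4)"
    unfolding norm_mult using assms R_pos \<delta>_pos by (intro mult_strict_mono') auto
  also have "\<dots> = 1" using \<delta>_pos by (simp add: R_def)
  finally show ?thesis by auto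
qed

text \<open>On the lower arc the shift by \<open>- \<i> * \<epsilon>\<close> points away from the
  real axis, so the modulus stays at least \<open>R\<close>, and
  \<open>1 / R = \<delta> / 2\<close>.\<close>

lemma arc_point:
  assumes "\<epsilon> \<ge> 0" and t: "t \<in> {pi..2 * pi}"
  defines "z \<equiv> of_real R * cis t - \<i> * of_real \<epsilon>"
  shows "z \<noteq> 0" "norm (1 / z) < \<delta>" "Im z \<le> - \<epsilon>"
proof -
  have s: "sin t \<le> 0"
    using t sin_ge_zero[of "t - pi"] by simp
  then have i: "R * sin t \<le> 0" using R_pos by (simp add: mult_nonneg_nonpos)
  then show "Im z \<le> - \<epsilon>" unfolding z_def by simp
  have "(R * sin t)\<^sup>2 \<le> (R * sin t - \<epsilon>)\<^sup>2"
    using i assms(1) by (simp add: abs_le_square_iff[symmetric])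
  then have "R\<^sup>2 \<le> (norm z)\<^sup>2"
    unfolding z_def cmod_power2 by (simp add: power_mult_distrib sin_squared_eq algebra_simps)
  then have "R \<le> norm z" by (rule power2_le_imp_le) simp
  moreover have "1 / R < \<delta>" using \<delta>_pos by (simp add: R_def)
  ultimately show "z \<noteq> 0" "norm (1 / z) < \<delta>"
    using R_pos frac_le[of 1 1 R "norm z"] by (auto simp: norm_divide)
qed

text \<open>The part of the disc of radius \<open>2 * R\<close> below height
  \<open>\<epsilon>\<close> is convex and contains both paths from \<open>- R\<close> to
  \<open>R\<close>. There \<open>\<zeta> - \<i> * \<epsilon>\<close> is in the lower half-plane, so
  the integrand is holomorphic and has a primitive.\<close>

lemma segment_integral_eq_arc_integral:
  assumes w: "norm w < \<delta> / 4" and "\<epsilon> > 0"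
  shows "segment_integral w \<epsilon> = arc_integral w \<epsilon>"
proof -
  define S where "S = {\<zeta>. Im \<zeta> < \<epsilon>} \<inter> ball 0 (2 * R)"
  define h where "h \<zeta> = 1 / (1 - \<zeta> * w) * P (1 / (\<zeta> - \<i> * of_real \<epsilon>))" for \<zeta>
  have "convex S" unfolding S_def by (intro convex_Int convex_halfspace_Im_lt convex_ball)
  have "open S" unfolding S_def by (intro open_Int open_halfspace_Im_lt open_ball)
  have upper: "Im (1 / (\<zeta> - \<i> * of_real \<epsilon>)) > 0" if "\<zeta> \<in> S" for \<zeta>
    by (rule Im_inverse_pos) (use that in \<open>simp add: S_def\<close>)
  have nz: "\<zeta> - \<i> * of_real \<epsilon> \<noteq> 0" if "\<zeta> \<in> S" for \<zeta>
    using upper[OF that] by auto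
  have "(P \<circ> (\<lambda>\<zeta>. 1 / (\<zeta> - \<i> * of_real \<epsilon>))) holomorphic_on S"
    by (rule holomorphic_on_compose_gen[OF _ P_holo]) (use upper nz in \<open>auto intro!: holomorphic_intros\<close>)
  then have "h holomorphic_on S"
    unfolding h_def o_def using test_function_nonzero[OF w]
    by (intro holomorphic_intros) (auto simp: S_def)
  then obtain F where F: "\<And>\<zeta>. \<zeta> \<in> S \<Longrightarrow> (F has_field_derivative h \<zeta>) (at \<zeta> within S)"
    using holomorphic_convex_primitive'[OF \<open>convex S\<close> \<open>open S\<close>] by metis
  have ends: "of_real (- R) \<in> S" "of_real R \<in> S"
    using R_pos \<open>\<epsilon> > 0\<close> by (auto simp: S_def)
  have "(h has_contour_integral F (of_real R) - F (of_real (- R))) (linepath (of_real (- R)) (of_real R))"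
    using contour_integral_primitive[OF F, where g = "linepath (of_real (- R)) (of_real R)"]
      closed_segment_subset[OF ends \<open>convex S\<close>] by simp
  moreover have "contour_integral (linepath (of_real (- R)) (of_real R)) h = segment_integral w \<epsilon>"
    unfolding segment_integral_def
    by (subst contour_integral_linepath_Reals_eq) (use R_pos in \<open>auto simp: h_def\<close>)
  ultimately have seg: "segment_integral w \<epsilon> = F (of_real R) - F (of_real (- R))"
    using contour_integral_unique by metis
  have arcS: "of_real R * cis t \<in> S" if "t \<in> {pi..2 * pi}" for t
    using arc_point(3)[of 0 t] that R_pos \<open>\<epsilon> > 0\<close> by (auto simp: S_def norm_mult)
  have "path_image (part_circlepath 0 R pi (2 * pi)) \<subseteq> S"
    using arcS by (auto simp: path_image_part_circlepath cis_conv_exp)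
  then have "(h has_contour_integral F (of_real R) - F (of_real (- R))) (part_circlepath 0 R pi (2 * pi))"
    using contour_integral_primitive[OF F, where g = "part_circlepath 0 R pi (2 * pi)"]
    by (simp add: mult.commute[of _ "complex_of_real pi"])
  then have "contour_integral (part_circlepath 0 R pi (2 * pi)) h = F (of_real R) - F (of_real (- R))"
    by (rule contour_integral_unique)
  moreover have "contour_integral (part_circlepath 0 R pi (2 * pi)) h = arc_integral w \<epsilon>"
    unfolding arc_integral_def
  proof (subst contour_integral_part_circlepath_eq, simp, rule integral_cong)
    fix t assume t: "t \<in> {pi..2 * pi}"
    let ?v = "1 / (of_real R * cis t - \<i> * of_real \<epsilon>)"
    have "P ?v = ?v * M ?v"
      by (rule P_eq) (use arc_point(2)[of \<epsilon> t] upper[OF arcS[OF t]] t \<open>\<epsilon> > 0\<close> in auto)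
    then show "h (0 + of_real R * cis t) * of_real R * \<i> * cis t = arc_integrand w \<epsilon> t"
      unfolding arc_integrand_def h_def Let_def by simp
  qed
  ultimately show ?thesis using seg by simp
qed

text \<open>This is the gain from moving the contour: on the arc the integrand is jointly continuous
  down to \<open>\<epsilon> = 0\<close>, whereas \<open>P\<close> need not extend to the real
  segment.\<close>

lemma arc_integral_tendsto:
  assumes w: "norm w < \<delta> / 4"
  shows "(\<lambda>n. arc_integral w (1 / Suc n)) \<longlonglongrightarrow> arc_integral w 0"
proof -
  have M_cont: "continuous_on (ball 0 \<delta>) M"
    using M_holo by (rule holomorphic_on_imp_continuous_on)
  have "continuous_on ({0..} \<times> cbox pi (2 * pi)) (\<lambda>(\<epsilon>, t). arc_integrand w \<epsilon> t)"
    unfolding arc_integrand_def Let_def case_prod_beta cis_conv_exp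
    using arc_point(1,2)[unfolded cis_conv_exp] test_function_nonzero[OF w] R_pos
    by (intro continuous_intros continuous_on_compose2[OF M_cont]) (auto simp: norm_mult)
  then have "continuous_on {0..} (arc_integral w)"
    unfolding arc_integral_def using integral_continuous_on_param by fastforce
  moreover have "(\<lambda>n. 1 / real (Suc n)) \<longlonglongrightarrow> 0"
    using LIMSEQ_inverse_real_of_nat by (simp add: inverse_eq_divide)
  ultimately show ?thesis
    by (rule continuous_on_tendsto_compose) auto
qed

text \<open>Conjugation maps the lower arc to the upper one, so both together make up the full circle,
  to which, after the substitution \<open>\<xi> = 1 / \<zeta>\<close>, Cauchy's formula applies.\<close>

lemma arc_integral_0:
  assumes w: "norm w < \<delta> / 4"
  shows "arc_integral w 0 - cnj (arc_integral (cnj w) 0) = 2 * of_real pi * \<i> * M w"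
proof -
  \<comment> \<open>The integrand of Cauchy's formula along \<open>\<xi> = cis t / R\<close>,
    including the velocity \<open>\<i> * \<xi>\<close>.\<close>
  define K where "K t = \<i> * (cis t / R) * M (cis t / R) / (cis t / R - w)" for t
  have near: "norm (cis t / of_real R) < \<delta>" "cis t / of_real R - w \<noteq> 0" for t
  proof -
    have n: "norm (cis t / of_real R) = \<delta> / 2" using \<delta>_pos by (simp add: norm_divide norm_mult R_def)
    then show "norm (cis t / of_real R) < \<delta>" using \<delta>_pos by simp
    show "cis t / of_real R - w \<noteq> 0" using n w \<delta>_pos by auto
  qed
  have M_cont: "continuous_on (ball 0 \<delta>) M"
    using M_holo by (rule holomorphic_on_imp_continuous_on)
  have K_cont: "continuous_on A K" for A
    unfolding K_def cis_conv_exp using near[unfolded cis_conv_exp]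
    by (intro continuous_intros continuous_on_compose2[OF M_cont]) (use R_pos in auto)
  have K_int: "K integrable_on {c..d}" for c d
    by (intro integrable_continuous_real K_cont)
  have K_periodic: "K (t + 2 * pi) = K t" for t
    unfolding K_def by (simp add: cis_mult[symmetric])
  have integrand_0: "arc_integrand w 0 t = K (- t)" for t
  proof -
    define \<zeta> where "\<zeta> = of_real R * cis t"
    have \<xi>: "cis (- t) / of_real R = 1 / \<zeta>"
      by (simp add: \<zeta>_def cis_inverse[symmetric] field_simps)
    moreover have "\<zeta> \<noteq> 0" using R_pos by (simp add: \<zeta>_def)
    ultimately show ?thesis
      unfolding arc_integrand_def K_def Let_def \<xi> \<zeta>_def[symmetric] by (simp add: divide_simps mult.commute)
  qed
  have integrand_cnj: "cnj (arc_integrand (cnj w) 0 t) = - K t" for t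
  proof -
    define \<zeta> where "\<zeta> = of_real R * cis t"
    have \<xi>: "cis t / of_real R = 1 / cnj \<zeta>"
      by (simp add: \<zeta>_def cis_cnj cis_inverse[symmetric] field_simps)
    have nz: "cnj \<zeta> \<noteq> 0" using R_pos by (simp add: \<zeta>_def)
    have "1 / \<zeta> = cis (- t) / of_real R"
      by (simp add: \<zeta>_def cis_inverse[symmetric] field_simps)
    then have "norm (1 / \<zeta>) < \<delta>"
      using near(1)[of "- t"] by simp
    then have "cnj (M (1 / \<zeta>)) = M (1 / cnj \<zeta>)"
      using M_cnj[of "1 / \<zeta>"] by simp
    then have "cnj (arc_integrand (cnj w) 0 t) =
        1 / (1 - cnj \<zeta> * w) * (1 / cnj \<zeta> * M (1 / cnj \<zeta>)) * (- \<i> * cnj \<zeta>)"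
      unfolding arc_integrand_def Let_def \<zeta>_def[symmetric] by simp
    then show ?thesis
      unfolding K_def \<xi> using nz by (simp add: divide_simps mult.commute)
  qed
  have "arc_integral w 0 = integral {pi..2 * pi} (\<lambda>t. K (- t))"
    unfolding arc_integral_def by (rule integral_cong) (rule integrand_0)
  \<comment> \<open>Inversion reverses the orientation; a shift by one period then brings the arc to
    \<open>{0..pi}\<close>.\<close>
  also have "\<dots> = integral {- (2 * pi)..- pi} K"
    using Henstock_Kurzweil_Integration.integral_reflect_real[of "- pi" "- (2 * pi)" K] by simp
  also have "\<dots> = integral {- (2 * pi)..- pi} (K \<circ> (\<lambda>t. t + 2 * pi))"
    using K_periodic by (simp add: o_def)
  also have "\<dots> = integral {0..pi} K"
    by (subst integral_shift) (auto intro: K_cont)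
  finally have 1: "arc_integral w 0 = integral {0..pi} K" .
  have "cnj (arc_integral (cnj w) 0) = integral {pi..2 * pi} (\<lambda>t. cnj (arc_integrand (cnj w) 0 t))"
    unfolding arc_integral_def by (simp add: integral_cnj)
  then have 2: "cnj (arc_integral (cnj w) 0) = - integral {pi..2 * pi} K"
    using integrand_cnj by simp
  \<comment> \<open>The radius \<open>1 / R = \<delta> / 2\<close> keeps the circle inside the
    domain of \<open>M\<close> and around \<open>w\<close>.\<close>
  have "((\<lambda>\<xi>. M \<xi> / (\<xi> - w)) has_contour_integral 2 * of_real pi * \<i> * M w) (circlepath 0 (1 / R))"
    by (rule Cauchy_integral_circlepath_simple[OF holomorphic_on_subset[OF M_holo]])
      (use w \<delta>_pos in \<open>auto simp: R_def\<close>)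
  then have "2 * of_real pi * \<i> * M w =
      contour_integral (part_circlepath 0 (1 / R) 0 (2 * pi)) (\<lambda>\<xi>. M \<xi> / (\<xi> - w))"
    unfolding circlepath_def by (simp add: contour_integral_unique)
  also have "\<dots> = integral {0..2 * pi} K"
    by (subst contour_integral_part_circlepath_eq) (auto simp: K_def mult_ac intro!: integral_cong)
  also have "\<dots> = integral {0..pi} K + integral {pi..2 * pi} K"
    by (rule Henstock_Kurzweil_Integration.integral_combine[symmetric]) (auto intro: K_int)
  finally show ?thesis using 1 2 by simp
qed

text \<open>Stieltjes inversion: the imaginary part of the Cauchy transform at height
  \<open>\<epsilon>\<close> below the real axis, divided by \<open>pi\<close>.\<close>

definition boundary_density :: "real \<Rightarrow> real \<Rightarrow> real" where
  "boundary_density \<epsilon> x = Im (P (1 / (of_real x - \<i> * of_real \<epsilon>))) / pi"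

lemma P_segment_cont:
  assumes "\<epsilon> > 0"
  shows "continuous_on A (\<lambda>x::real. P (1 / (of_real x - \<i> * of_real \<epsilon>)))"
proof (rule continuous_on_compose2[OF holomorphic_on_imp_continuous_on[OF P_holo]])
  have "complex_of_real x - \<i> * of_real \<epsilon> \<noteq> 0" for x
    using assms by (auto simp: complex_eq_iff)
  then show "continuous_on A (\<lambda>x::real. 1 / (complex_of_real x - \<i> * of_real \<epsilon>))"
    by (intro continuous_intros) auto
  show "(\<lambda>x::real. 1 / (complex_of_real x - \<i> * of_real \<epsilon>)) ` A \<subseteq> {w. Im w > 0}"
    using assms by (auto intro!: Im_inverse_pos)
qed

lemma test_function_cont:
  assumes "norm w < \<delta> / 4"
  shows "continuous_on {- R..R} (\<lambda>x. 1 / (1 - complex_of_real x * w))"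
  using test_function_nonzero[OF assms] R_pos by (intro continuous_intros) auto

text \<open>The imaginary part is \<open>(z - cnj z) / (2 * \<i>)\<close>. The second integral is
  taken at \<open>cnj w\<close> so that conjugation restores the test function at
  \<open>w\<close>.\<close>

lemma integral_boundary_density:
  assumes w: "norm w < \<delta> / 4" and "\<epsilon> > 0"
  shows "integral {- R..R} (\<lambda>x. boundary_density \<epsilon> x *\<^sub>R (1 / (1 - of_real x * w))) =
    (segment_integral w \<epsilon> - cnj (segment_integral (cnj w) \<epsilon>)) / (2 * of_real pi * \<i>)"
proof -
  let ?P = "\<lambda>x::real. P (1 / (of_real x - \<i> * of_real \<epsilon>))"
  let ?f = "\<lambda>x::real. 1 / (1 - of_real x * w)"
  have int: "(\<lambda>x. ?f x * ?P x) integrable_on {- R..R}" "(\<lambda>x. ?f x * cnj (?P x)) integrable_on {- R..R}"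
    by (intro integrable_continuous_real continuous_intros test_function_cont[OF w] P_segment_cont[OF \<open>\<epsilon> > 0\<close>])+
  have "cnj (segment_integral (cnj w) \<epsilon>) = integral {- R..R} (\<lambda>x. ?f x * cnj (?P x))"
    unfolding segment_integral_def by (simp add: integral_cnj)
  then have "segment_integral w \<epsilon> - cnj (segment_integral (cnj w) \<epsilon>) =
      integral {- R..R} (\<lambda>x. ?f x * ?P x - ?f x * cnj (?P x))"
    unfolding segment_integral_def by (simp only: Henstock_Kurzweil_Integration.integral_diff[OF int])
  also have "\<dots> = integral {- R..R} (\<lambda>x. (2 * of_real pi * \<i>) * (boundary_density \<epsilon> x *\<^sub>R ?f x))"
  proof (rule integral_cong)
    fix x :: real
    have "?f x * ?P x - ?f x * cnj (?P x) = ?f x * (?P x - cnj (?P x))"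
      by (simp only: right_diff_distrib)
    also have "\<dots> = (2 * of_real pi * \<i>) * (boundary_density \<epsilon> x *\<^sub>R ?f x)"
      unfolding complex_diff_cnj boundary_density_def by (simp add: scaleR_conv_of_real)
    finally show "?f x * ?P x - ?f x * cnj (?P x) = (2 * of_real pi * \<i>) * (boundary_density \<epsilon> x *\<^sub>R ?f x)" .
  qed
  also have "\<dots> = (2 * of_real pi * \<i>) * integral {- R..R} (\<lambda>x. boundary_density \<epsilon> x *\<^sub>R ?f x)"
    by (rule integral_mult_right)
  finally show ?thesis by simp
qed

lemma integral_boundary_density_tendsto:
  assumes w: "norm w < \<delta> / 4"
  shows "(\<lambda>n. integral {- R..R} (\<lambda>x. boundary_density (1 / Suc n) x *\<^sub>R (1 / (1 - of_real x * w))))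
    \<longlonglongrightarrow> M w"
proof -
  have "(\<lambda>n. (arc_integral w (1 / Suc n) - cnj (arc_integral (cnj w) (1 / Suc n))) / (2 * of_real pi * \<i>))
    \<longlonglongrightarrow> (arc_integral w 0 - cnj (arc_integral (cnj w) 0)) / (2 * of_real pi * \<i>)"
    by (intro tendsto_intros arc_integral_tendsto) (use w in auto)
  then show ?thesis
    using w by (simp add: arc_integral_0 integral_boundary_density segment_integral_eq_arc_integral)
qed

text \<open>A weak limit of the boundary densities integrates \<open>1 / (1 - x * w)\<close> both to
  its moment generating function and to the limit \<open>M w\<close> found by contours.\<close>

proposition representing_measure:
  obtains \<mu> where "real_distribution \<mu>" "compactly_supported \<mu>"
    "\<And>w. norm w < \<delta> / 4 \<Longrightarrow> moment_gf \<mu> w = M w"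
proof -
  define \<rho> where "\<rho> n = boundary_density (1 / Suc n)" for n
  have cont: "continuous_on {- R..R} (\<rho> n)" for n
    unfolding \<rho>_def boundary_density_def by (intro continuous_intros P_segment_cont) auto
  have pos: "\<rho> n x > 0" for n x
    unfolding \<rho>_def boundary_density_def by (intro divide_pos_pos P_pos Im_inverse_pos) auto
  \<comment> \<open>At \<open>w = 0\<close> the test function is 1, so the masses tend to
    \<open>M 0 = 1\<close>.\<close>
  have "(\<lambda>n. integral {- R..R} (\<lambda>x. complex_of_real (\<rho> n x))) \<longlonglongrightarrow> 1"
    using integral_boundary_density_tendsto[of 0] \<delta>_pos by (simp add: \<rho>_def M_0 scaleR_conv_of_real)
  then have "(\<lambda>n. complex_of_real (integral {- R..R} (\<rho> n))) \<longlonglongrightarrow> of_real 1"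
    using integral_linear[OF integrable_continuous_real[OF cont] bounded_linear_of_real[where 'a = complex]]
    by (simp add: o_def[abs_def])
  then have mass: "(\<lambda>n. integral {- R..R} (\<rho> n)) \<longlonglongrightarrow> 1"
    unfolding tendsto_of_real_iff .
  have "- R < R" using R_pos by simp
  then obtain r \<mu> where r: "strict_mono (r :: nat \<Rightarrow> nat)" and \<mu>: "real_distribution \<mu>" "AE x in \<mu>. x \<in> {- R..R}"
    and lim: "\<And>f :: real \<Rightarrow> complex. f \<in> borel_measurable borel \<Longrightarrow> continuous_on {- R..R} f \<Longrightarrow>
      (\<lambda>n. integral {- R..R} (\<lambda>x. \<rho> (r n) x *\<^sub>R f x)) \<longlonglongrightarrow> (LINT x|\<mu>. f x)"
    using densities_on_Icc_convergent_subsequence[OF _ cont pos mass] by blast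
  show ?thesis
  proof (rule that[OF \<mu>(1)])
    show "compactly_supported \<mu>"
      unfolding compactly_supported_def using \<mu>(2) by blast
    fix w :: complex assume w: "norm w < \<delta> / 4"
    have "(\<lambda>n. integral {- R..R} (\<lambda>x. \<rho> (r n) x *\<^sub>R (1 / (1 - of_real x * w)))) \<longlonglongrightarrow> moment_gf \<mu> w"
      unfolding moment_gf_def by (intro lim test_function_cont w) measurable
    moreover have "(\<lambda>n. integral {- R..R} (\<lambda>x. \<rho> (r n) x *\<^sub>R (1 / (1 - of_real x * w)))) \<longlonglongrightarrow> M w"
      using LIMSEQ_subseq_LIMSEQ[OF integral_boundary_density_tendsto[OF w] r] by (simp add: o_def \<rho>_def)
    ultimately show "moment_gf \<mu> w = M w" by (rule LIMSEQ_unique)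
  qed
qed

end

subsection \<open>The R-transform\<close>

text \<open>Multiplying \<open>z\<close> by the conjugate denominator only adds the real number
  \<open>r * (norm z)\<^sup>2\<close>.\<close>

lemma Im_moebius_pos:
  fixes z :: complex and r :: real
  assumes "Im z > 0"
  shows "1 + of_real r * z \<noteq> 0" "Im (z / (1 + of_real r * z)) > 0"
proof -
  show nz: "1 + of_real r * z \<noteq> 0"
    using assms by (cases "r = 0") (auto simp: complex_eq_iff)
  have "Im (z / (1 + of_real r * z)) = Im z / (norm (1 + of_real r * z))\<^sup>2"
    unfolding Im_divide cmod_power2 by (simp add: algebra_simps)
  then show "Im (z / (1 + of_real r * z)) > 0"
    using assms nz by simp
qed

text \<open>In partial fractions, \<open>c * y\<close> cancels the pole at infinity of
  \<open>(1 - x * y) ^ 3 / ((1 - u * y) * (1 - v * y))\<close>, and the prescribed weights come from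
  the poles at \<open>1 / u\<close> and \<open>1 / v\<close>. The substitution for \<open>y\<close>
  then lowers \<open>u\<close> and \<open>v\<close> by \<open>x\<close>.\<close>

lemma moebius_cubic_inverse:
  fixes u v x c :: real and t w y :: complex
  assumes "u \<noteq> 0" "v \<noteq> 0" "u \<noteq> v" and c: "c = x ^ 3 / (u * v)"
    and t: "real_rooted_cubic (u - x) (v - x) t = w / (1 - of_real c * w)"
    and nz: "1 - of_real c * w \<noteq> 0" "1 + of_real x * t \<noteq> 0"
      "1 - of_real u * y \<noteq> 0" "1 - of_real v * y \<noteq> 0"
    and y: "y = t / (1 + of_real x * t)"
  shows "y = w * (1 + (of_real ((u - x) ^ 3 / (u\<^sup>2 * (u - v))) *
        (of_real u * y / (1 - of_real u * y)) +
      of_real ((v - x) ^ 3 / (v\<^sup>2 * (v - u))) *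
        (of_real v * y / (1 - of_real v * y))))"
proof -
  let ?R = "of_real ((u - x) ^ 3 / (u\<^sup>2 * (u - v))) * (of_real u * y / (1 - of_real u * y)) +
      of_real ((v - x) ^ 3 / (v\<^sup>2 * (v - u))) * (of_real v * y / (1 - of_real v * y))"
  let ?d = "(1 - of_real u * y) * (1 - of_real v * y)"
  have uv: "complex_of_real u \<noteq> 0" "complex_of_real v \<noteq> 0" "complex_of_real u - of_real v \<noteq> 0"
    using assms(1-3) by auto
  have R: "1 + ?R = (1 - of_real x * y) ^ 3 / ?d + of_real c * y"
  proof -
    define U V X where "U = complex_of_real u" and "V = complex_of_real v" and "X = complex_of_real x"
    \<comment> \<open>Making the nonzero difference a variable turns the claim, after clearing
      denominators, into a polynomial identity.\<close>
    define d where "d = U - V"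
    have U: "U = V + d" by (simp add: d_def)
    have nz': "V + d \<noteq> 0" "V \<noteq> 0" "d \<noteq> 0" "1 - (V + d) * y \<noteq> 0" "1 - V * y \<noteq> 0"
      using uv nz by (auto simp: U_def V_def d_def)
    have "1 + ((V + d - X) ^ 3 / ((V + d)\<^sup>2 * d) * ((V + d) * y / (1 - (V + d) * y))
       - (V - X) ^ 3 / (V\<^sup>2 * d) * (V * y / (1 - V * y)))
      = (1 - X * y) ^ 3 / ((1 - (V + d) * y) * (1 - V * y)) + X ^ 3 / ((V + d) * V) * y"
      using nz' by (simp add: divide_simps) algebra
    then have "1 + ((U - X) ^ 3 / (U\<^sup>2 * (U - V)) * (U * y / (1 - U * y))
       + (V - X) ^ 3 / (V\<^sup>2 * (V - U)) * (V * y / (1 - V * y)))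
      = (1 - X * y) ^ 3 / ((1 - U * y) * (1 - V * y)) + X ^ 3 / (U * V) * y"
      unfolding U using nz'(3) by (simp add: divide_simps)
    then show ?thesis unfolding c U_def V_def X_def by simp
  qed
  have xy: "1 - of_real x * y = 1 / (1 + of_real x * t)"
    unfolding y using nz(2) by (simp add: field_simps)
  have ry: "1 - of_real r * y = (1 - of_real (r - x) * t) / (1 + of_real x * t)" for r
    unfolding y using nz(2) by (simp add: field_simps)
  have "y * ?d = w / (1 - of_real c * w) * (1 - of_real x * y) ^ 3"
    unfolding t[symmetric] real_rooted_cubic_def ry[of u] ry[of v] xy
    by (subst (1) y) (simp add: power3_eq_cube mult.assoc)
  then have "w * (1 - of_real x * y) ^ 3 = y * ?d * (1 - of_real c * w)"
    using nz(1) by (simp add: field_simps)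
  moreover define D where "D = ?d"
  moreover have "D \<noteq> 0" using nz(3,4) by (simp add: D_def)
  ultimately have "w * ((1 - of_real x * y) ^ 3 / ?d) = y * (1 - of_real c * w)"
    by simp
  then have "w * (1 + ?R) = y"
    unfolding R by (simp add: algebra_simps)
  then show ?thesis by simp
qed

section \<open>Assembling the germ, its half-plane extension and the measure\<close>

theorem proposition5p3:
  fixes u v x :: real
  assumes "u \<noteq> 0" and "v \<noteq> 0" and "u \<noteq> v"
  shows "\<exists>\<mu> :: real measure. real_distribution \<mu> \<and> compactly_supported \<mu> \<and>
    has_free_R_transform \<mu> (\<lambda>w :: complex.
      complex_of_real ((u - x) ^ 3 / (u\<^sup>2 * (u - v))) *
        (complex_of_real u * w / (1 - complex_of_real u * w)) +
      complex_of_real ((v - x) ^ 3 / (v\<^sup>2 * (v - u))) *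
        (complex_of_real v * w / (1 - complex_of_real v * w)))"
proof (rule cubic_inverse_branch[of "u - x" "v - x"])
  show "u - x \<noteq> v - x" using assms by simp
  fix \<tau> g \<delta>\<^sub>1
  assume \<tau>: "\<tau> holomorphic_on {w. Im w > 0}" "\<And>w. Im w > 0 \<Longrightarrow> Im (\<tau> w) > 0"
    and \<delta>\<^sub>1: "\<delta>\<^sub>1 > 0" and g: "g holomorphic_on ball 0 \<delta>\<^sub>1" "g 0 = 0"
      "\<And>w. norm w < \<delta>\<^sub>1 \<Longrightarrow> real_rooted_cubic (u - x) (v - x) (g w) = w"
      "\<And>w. norm w < \<delta>\<^sub>1 \<Longrightarrow> g (cnj w) = cnj (g w)"
      "\<And>w. norm w < \<delta>\<^sub>1 \<Longrightarrow> Im w > 0 \<Longrightarrow> g w = \<tau> w"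
  define c where "c = x ^ 3 / (u * v)"
  \<comment> \<open>\<open>W w\<close> is the argument of the inverse cubic, \<open>g (W w)\<close>
    is its root \<open>t\<close>, and \<open>N w\<close> is the germ \<open>y\<close>.\<close>
  define W where "W w = w / (1 - of_real c * w)" for w :: complex
  define N where "N w = g (W w) / (1 + of_real x * g (W w))" for w
  define A B where "A = (u - x) ^ 3 / (u\<^sup>2 * (u - v))" and "B = (v - x) ^ 3 / (v\<^sup>2 * (v - u))"
  define \<R> where "\<R> y = of_real A * (of_real u * y / (1 - of_real u * y)) +
    of_real B * (of_real v * y / (1 - of_real v * y))" for y :: complex
  \<comment> \<open>Defining \<open>M\<close> through \<open>\<R>\<close> avoids dividing
    \<open>N w\<close> by \<open>w\<close> at 0; the functional equation then amounts to
    \<open>N w = w * M w\<close>.\<close>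
  define M where "M w = 1 + \<R> (N w)" for w
  define P where "P w = \<tau> (W w) / (1 + of_real x * \<tau> (W w))" for w
  have "isCont g 0"
    using holomorphic_on_imp_continuous_on[OF g(1)] \<delta>\<^sub>1 by (simp add: continuous_on_eq_continuous_at)
  then have g_lim: "(g \<longlongrightarrow> 0) (nhds 0)"
    using g(2) unfolding isCont_def tendsto_at_iff_tendsto_nhds by simp
  have c_lim: "((\<lambda>w. 1 - of_real c * w) \<longlongrightarrow> 1) (nhds (0::complex))"
    by (rule tendsto_eq_intros filterlim_ident refl | simp)+
  have W_lim: "(W \<longlongrightarrow> 0) (nhds 0)"
    unfolding W_def[abs_def] by (rule tendsto_eq_intros filterlim_ident refl c_lim | simp)+
  have gW_lim: "((\<lambda>w. g (W w)) \<longlongrightarrow> 0) (nhds 0)"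
    by (rule filterlim_compose[OF g_lim W_lim])
  have x_lim: "((\<lambda>w. 1 + of_real x * g (W w)) \<longlongrightarrow> 1) (nhds 0)"
    by (rule tendsto_eq_intros gW_lim refl | simp)+
  have N_lim: "(N \<longlongrightarrow> 0) (nhds 0)"
    unfolding N_def[abs_def] by (rule tendsto_eq_intros gW_lim refl | simp)+
  have r_lim: "((\<lambda>w. 1 - of_real r * N w) \<longlongrightarrow> 1) (nhds 0)" for r
    by (rule tendsto_eq_intros N_lim refl | simp)+
  \<comment> \<open>All denominators tend to 1 and \<open>W\<close> tends to 0, so one disc avoids
    every pole and stays in the domain of \<open>g\<close>.\<close>
  have "\<forall>\<^sub>F w in nhds 0. 1 - of_real c * w \<noteq> 0 \<and> norm (W w) < \<delta>\<^sub>1 \<and> 1 + of_real x * g (W w) \<noteq> 0 \<and>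
      1 - of_real u * N w \<noteq> 0 \<and> 1 - of_real v * N w \<noteq> 0"
    using tendstoD[OF W_lim \<delta>\<^sub>1]
    by (intro eventually_conj tendsto_imp_eventually_ne[OF c_lim] tendsto_imp_eventually_ne[OF x_lim]
        tendsto_imp_eventually_ne[OF r_lim]) (simp_all add: dist_norm)
  then obtain \<delta> where \<delta>: "\<delta> > 0"
    and near: "\<And>w. norm w < \<delta> \<Longrightarrow> 1 - of_real c * w \<noteq> 0 \<and> norm (W w) < \<delta>\<^sub>1 \<and>
      1 + of_real x * g (W w) \<noteq> 0 \<and> 1 - of_real u * N w \<noteq> 0 \<and> 1 - of_real v * N w \<noteq> 0"
    unfolding eventually_nhds_metric by (auto simp: dist_norm)
  have N_eq: "N w = w * M w" if "norm w < \<delta>" for w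
  proof -
    have "real_rooted_cubic (u - x) (v - x) (g (W w)) = w / (1 - of_real c * w)"
      using g(3)[of "W w"] near[OF that] by (simp add: W_def)
    then show ?thesis
      unfolding M_def \<R>_def A_def B_def
      by (rule moebius_cubic_inverse[OF assms c_def]) (use near[OF that] in \<open>auto simp: N_def\<close>)
  qed
  have W_pos: "Im (W w) > 0" "1 - of_real c * w \<noteq> 0" if "Im w > 0" for w
    using Im_moebius_pos[OF that, of "- c"] by (auto simp: W_def)
  interpret nevanlinna_germ M P \<delta>
  proof
    show "\<delta> > 0" by (rule \<delta>)
    have "W holomorphic_on ball 0 \<delta>"
      unfolding W_def[abs_def] using near by (intro holomorphic_intros) auto
    then have "(g \<circ> W) holomorphic_on ball 0 \<delta>"
      by (rule holomorphic_on_compose_gen[OF _ g(1)]) (use near in auto)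
    then have "N holomorphic_on ball 0 \<delta>"
      unfolding N_def[abs_def] o_def using near by (intro holomorphic_intros) auto
    then show "M holomorphic_on ball 0 \<delta>"
      unfolding M_def[abs_def] \<R>_def using near by (intro holomorphic_intros) auto
    show "M 0 = 1"
      using g(2) by (simp add: M_def \<R>_def N_def W_def)
    show "M (cnj w) = cnj (M w)" if "norm w < \<delta>" for w
    proof -
      have "W (cnj w) = cnj (W w)" by (simp add: W_def)
      then have "N (cnj w) = cnj (N w)"
        using g(4)[of "W w"] near[OF that] by (simp add: N_def)
      then show ?thesis by (simp add: M_def \<R>_def)
    qed
    have "W holomorphic_on {w. Im w > 0}"
      unfolding W_def[abs_def] using W_pos(2) by (intro holomorphic_intros) auto
    then have "(\<tau> \<circ> W) holomorphic_on {w. Im w > 0}"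
      by (rule holomorphic_on_compose_gen[OF _ \<tau>(1)]) (use W_pos(1) in auto)
    then show "P holomorphic_on {w. Im w > 0}"
      unfolding P_def[abs_def] o_def using Im_moebius_pos(1)[OF \<tau>(2)] W_pos(1)
      by (intro holomorphic_intros) auto
    show "Im (P w) > 0" if "Im w > 0" for w
      unfolding P_def by (intro Im_moebius_pos(2) \<tau>(2) W_pos(1) that)
    show "P w = w * M w" if "norm w < \<delta>" "Im w > 0" for w
      using N_eq[OF that(1)] g(5)[of "W w"] near[OF that(1)] W_pos(1)[OF that(2)]
      by (simp add: P_def N_def)
  qed
  show ?thesis
  proof (rule representing_measure)
    fix \<mu> assume \<mu>: "real_distribution \<mu>" "compactly_supported \<mu>"
      and mgf: "\<And>w. norm w < \<delta> / 4 \<Longrightarrow> moment_gf \<mu> w = M w"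
    have "\<R> analytic_on {0}"
      unfolding \<R>_def[abs_def] by (intro analytic_intros) auto
    moreover have "\<forall>\<^sub>F z in nhds 0. 1 + \<R> (z * moment_gf \<mu> z) = moment_gf \<mu> z"
      unfolding eventually_nhds_metric
    proof (intro exI conjI allI impI)
      show "\<delta> / 4 > 0" using \<delta> by simp
      fix z :: complex assume "dist z 0 < \<delta> / 4"
      then have z: "norm z < \<delta> / 4" "norm z < \<delta>" using \<delta> by auto
      have "z * moment_gf \<mu> z = N z" by (simp only: mgf[OF z(1)] N_eq[OF z(2)])
      then show "1 + \<R> (z * moment_gf \<mu> z) = moment_gf \<mu> z"
        by (simp only: mgf[OF z(1)] M_def)
    qed
    ultimately show ?thesis
      using \<mu> unfolding has_free_R_transform_def \<R>_def A_def B_def by blast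
  qed
qed

end
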